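(* Let $\mathfrak{m}$ be the real graded vector space with basis $v_3$ (odd) and $v_6$ (even) and with graded brackets $[v_3,v_3]=v_6$, $[v_3,v_6]=0$, $[v_6,v_6]=0$. Then, with respect to the even/odd grading, $v_3$ and $v_6$ form a Lie superalgebra, which is isomorphic to the Lie superalgebra of supertranslations in $(1|1)$ dimensions.
   Context: The graded brackets are those of the gauge algebra of the M-theory $C$-field and its dual: $v_3$ and $v_6$ are the generators of the gauge transformations of the degree $3$ potential $C_3$ and of the degree $6$ dual potential $C_6$. The bracket of two odd elements is symmetric (an anticommutator). The Lie superalgebra of supertranslations in $(1|1)$ dimensions is the real Lie superalgebra spanned by the odd vector field $Q=\frac{\partial}{\partial\theta}+\theta\frac{\partial}{\partial x}$ and the even vector field $\frac{\partial}{\partial x}$ on $\mathbb{R}^{1|1}$ (with even coordinate $x$ and odd coordinate $\theta$), under the super commutator. *)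

theory Defs
  imports "HOL-Analysis.Analysis" "HOL-Library.Z2"
begin

text \<open>Parities are elements of the field \<^typ>\<open>bit\<close> with two elements: 0 is even, 1 is odd.
  The Koszul sign \<open>(-1)^(p * q)\<close> is written \<open>ksign p q\<close>.\<close>

definition ksign :: "bit \<Rightarrow> bit \<Rightarrow> real" where
  "ksign p q = (if p = 1 \<and> q = 1 then -1 else 1)"

lemma bit_arith [simp]: "(1::bit) + 1 = 0"
  using bit_2_eq_0 by (simp only: one_add_one)

lemma all_bit: "(\<forall>p::bit. P p) \<longleftrightarrow> P 0 \<and> P 1"
  by (metis bit.exhaust)


section \<open>Real Lie superalgebras\<close>

text \<open>A super vector space is given by its family \<open>V\<close> of even and odd parts, which are subspaces
  of an ambient real vector space. Nothing is required of the bracket outside of the carrier.\<close>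

definition super_carrier :: "(bit \<Rightarrow> 'a::real_vector set) \<Rightarrow> 'a set" where
  "super_carrier V = {x + y | x y. x \<in> V 0 \<and> y \<in> V 1}"

locale lie_superalgebra =
  fixes V :: "bit \<Rightarrow> 'a::real_vector set"
    and br :: "'a \<Rightarrow> 'a \<Rightarrow> 'a"
  assumes part_subspace: "subspace (V p)"
    and parts_disjoint: "V 0 \<inter> V 1 = {0}"
    and bracket_add_left:
      "\<lbrakk>x \<in> super_carrier V; y \<in> super_carrier V; z \<in> super_carrier V\<rbrakk>
        \<Longrightarrow> br (x + y) z = br x z + br y z"
    and bracket_add_right:
      "\<lbrakk>x \<in> super_carrier V; y \<in> super_carrier V; z \<in> super_carrier V\<rbrakk>
        \<Longrightarrow> br x (y + z) = br x y + br x z"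
    and bracket_scaleR_left:
      "\<lbrakk>x \<in> super_carrier V; y \<in> super_carrier V\<rbrakk> \<Longrightarrow> br (c *\<^sub>R x) y = c *\<^sub>R br x y"
    and bracket_scaleR_right:
      "\<lbrakk>x \<in> super_carrier V; y \<in> super_carrier V\<rbrakk> \<Longrightarrow> br x (c *\<^sub>R y) = c *\<^sub>R br x y"
    and bracket_graded: "\<lbrakk>x \<in> V p; y \<in> V q\<rbrakk> \<Longrightarrow> br x y \<in> V (p + q)"
    and super_skew_symmetry: "\<lbrakk>x \<in> V p; y \<in> V q\<rbrakk> \<Longrightarrow> br x y = - (ksign p q *\<^sub>R br y x)"
    and super_jacobi: "\<lbrakk>x \<in> V p; y \<in> V q; z \<in> V r\<rbrakk>
        \<Longrightarrow> br x (br y z) = br (br x y) z + ksign p q *\<^sub>R br y (br x z)"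

definition lie_superalgebra_iso ::
  "(bit \<Rightarrow> 'a::real_vector set) \<Rightarrow> ('a \<Rightarrow> 'a \<Rightarrow> 'a) \<Rightarrow>
   (bit \<Rightarrow> 'b::real_vector set) \<Rightarrow> ('b \<Rightarrow> 'b \<Rightarrow> 'b) \<Rightarrow> ('a \<Rightarrow> 'b) \<Rightarrow> bool" where
  "lie_superalgebra_iso V br W br' \<phi> \<longleftrightarrow>
     (\<forall>x\<in>super_carrier V. \<forall>y\<in>super_carrier V. \<phi> (x + y) = \<phi> x + \<phi> y) \<and>
     (\<forall>c. \<forall>x\<in>super_carrier V. \<phi> (c *\<^sub>R x) = c *\<^sub>R \<phi> x) \<and>
     bij_betw \<phi> (super_carrier V) (super_carrier W) \<and>
     (\<forall>p. \<phi> ` V p = W p) \<and>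
     (\<forall>x\<in>super_carrier V. \<forall>y\<in>super_carrier V. \<phi> (br x y) = br' (\<phi> x) (\<phi> y))"

definition lie_superalgebra_isomorphic ::
  "(bit \<Rightarrow> 'a::real_vector set) \<Rightarrow> ('a \<Rightarrow> 'a \<Rightarrow> 'a) \<Rightarrow>
   (bit \<Rightarrow> 'b::real_vector set) \<Rightarrow> ('b \<Rightarrow> 'b \<Rightarrow> 'b) \<Rightarrow> bool" where
  "lie_superalgebra_isomorphic V br W br' \<longleftrightarrow> (\<exists>\<phi>. lie_superalgebra_iso V br W br' \<phi>)"


section \<open>Smooth functions on the real line\<close>

definition smooth :: "(real \<Rightarrow> real) \<Rightarrow> bool" where
  "smooth f \<longleftrightarrow> (\<forall>n x. (deriv ^^ n) f field_differentiable at x)"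

lemma smooth_iff: "smooth f \<longleftrightarrow> (\<forall>x. f field_differentiable at x) \<and> smooth (deriv f)"
proof
  assume f: "smooth f"
  have "(deriv ^^ n) (deriv f) = (deriv ^^ Suc n) f" for n
    by (simp add: funpow_Suc_right del: funpow.simps)
  with f show "(\<forall>x. f field_differentiable at x) \<and> smooth (deriv f)"
    unfolding smooth_def by (metis funpow_0)
next
  assume a: "(\<forall>x. f field_differentiable at x) \<and> smooth (deriv f)"
  show "smooth f" unfolding smooth_def
  proof (intro allI)
    fix n x show "(deriv ^^ n) f field_differentiable at x"
      using a by (cases n) (auto simp: smooth_def funpow_Suc_right simp del: funpow.simps)
  qed
qed

lemma smooth_diff: "smooth f \<Longrightarrow> f field_differentiable at x"
  and smooth_deriv: "smooth f \<Longrightarrow> smooth (deriv f)"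
  using smooth_iff by blast+

lemma smooth_coinduct:
  assumes "P f" and step: "\<And>f. P f \<Longrightarrow> (\<forall>x. f field_differentiable at x) \<and> P (deriv f)"
  shows "smooth f"
proof -
  have "P ((deriv ^^ n) f)" for n by (induction n) (use assms in auto)
  with step show ?thesis unfolding smooth_def by blast
qed

lemma smooth_const: "smooth (\<lambda>x. c)"
  by (rule smooth_coinduct[where P="\<lambda>f. \<exists>c. f = (\<lambda>x. c)"])
    (auto simp: field_differentiable_const)

lemma smooth_add:
  assumes "smooth f" "smooth g" shows "smooth (\<lambda>x. f x + g x)"
proof (rule smooth_coinduct[where P="\<lambda>h. \<exists>f g. smooth f \<and> smooth g \<and> h = (\<lambda>x. f x + g x)"])
  show "\<exists>f' g'. smooth f' \<and> smooth g' \<and> (\<lambda>x. f x + g x) = (\<lambda>x. f' x + g' x)"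
    using assms by blast
next
  fix h :: "real \<Rightarrow> real"
  assume "\<exists>f g. smooth f \<and> smooth g \<and> h = (\<lambda>x. f x + g x)"
  then obtain f g where fg: "smooth f" "smooth g" and h: "h = (\<lambda>x. f x + g x)" by blast
  have "deriv h = (\<lambda>x. deriv f x + deriv g x)"
    unfolding h using fg by (intro ext deriv_add smooth_diff)
  then show "(\<forall>x. h field_differentiable at x) \<and>
      (\<exists>f g. smooth f \<and> smooth g \<and> deriv h = (\<lambda>x. f x + g x))"
    using fg unfolding h by (auto intro: smooth_deriv field_differentiable_add smooth_diff)
qed

inductive prod_sum :: "(real \<Rightarrow> real) \<Rightarrow> bool" where
  prod: "smooth f \<Longrightarrow> smooth g \<Longrightarrow> prod_sum (\<lambda>x. f x * g x)"
| plus: "prod_sum f \<Longrightarrow> prod_sum g \<Longrightarrow> prod_sum (\<lambda>x. f x + g x)"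

lemma prod_sum_step: "prod_sum h \<Longrightarrow> (\<forall>x. h field_differentiable at x) \<and> prod_sum (deriv h)"
proof (induction rule: prod_sum.induct)
  case (prod f g)
  have "deriv (\<lambda>x. f x * g x) = (\<lambda>x. f x * deriv g x + deriv f x * g x)"
    using prod by (intro ext deriv_mult smooth_diff)
  moreover have "prod_sum \<dots>"
    using prod by (intro prod_sum.intros smooth_deriv)
  ultimately show ?case using prod by (auto intro: field_differentiable_mult smooth_diff)
next
  case (plus f g)
  have "deriv (\<lambda>x. f x + g x) = (\<lambda>x. deriv f x + deriv g x)"
    using plus by (intro ext deriv_add) auto
  with plus show ?case by (auto intro: prod_sum.plus field_differentiable_add)
qed

lemma smooth_mult: "smooth f \<Longrightarrow> smooth g \<Longrightarrow> smooth (\<lambda>x. f x * g x)"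
  using smooth_coinduct[of prod_sum] prod_sum_step prod_sum.prod by blast

lemma smooth_uminus: "smooth f \<Longrightarrow> smooth (\<lambda>x. - f x)"
  using smooth_mult[OF smooth_const[of "-1"]] by simp

lemma smooth_minus: "smooth f \<Longrightarrow> smooth g \<Longrightarrow> smooth (\<lambda>x. f x - g x)"
  using smooth_add[OF _ smooth_uminus] by simp

typedef smooth_fun = "{f. smooth f}"
  using smooth_const by blast

setup_lifting type_definition_smooth_fun

instantiation smooth_fun :: "{comm_ring_1, real_algebra_1}"
begin
lift_definition zero_smooth_fun :: smooth_fun is "\<lambda>x. 0" by (rule smooth_const)
lift_definition one_smooth_fun :: smooth_fun is "\<lambda>x. 1" by (rule smooth_const)
lift_definition plus_smooth_fun :: "smooth_fun \<Rightarrow> smooth_fun \<Rightarrow> smooth_fun"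
  is "\<lambda>f g x. f x + g x" by (rule smooth_add)
lift_definition minus_smooth_fun :: "smooth_fun \<Rightarrow> smooth_fun \<Rightarrow> smooth_fun"
  is "\<lambda>f g x. f x - g x" by (rule smooth_minus)
lift_definition uminus_smooth_fun :: "smooth_fun \<Rightarrow> smooth_fun"
  is "\<lambda>f x. - f x" by (rule smooth_uminus)
lift_definition times_smooth_fun :: "smooth_fun \<Rightarrow> smooth_fun \<Rightarrow> smooth_fun"
  is "\<lambda>f g x. f x * g x" by (rule smooth_mult)
lift_definition scaleR_smooth_fun :: "real \<Rightarrow> smooth_fun \<Rightarrow> smooth_fun"
  is "\<lambda>c f x. c * f x" by (rule smooth_mult[OF smooth_const])
instance
  by standard (transfer; auto simp: algebra_simps fun_eq_iff)+
end

lift_definition derivative :: "smooth_fun \<Rightarrow> smooth_fun" is deriv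
  by (rule smooth_deriv)

lemma derivative_simps [simp]:
  "derivative (f + g) = derivative f + derivative g"
  "derivative (c *\<^sub>R f) = c *\<^sub>R derivative f"
  "derivative (f * g) = derivative f * g + f * derivative g"
  "derivative 0 = 0"
  by (transfer; auto simp: fun_eq_iff smooth_diff deriv_cmult algebra_simps)+


section \<open>Superfunctions on \<open>R^(1|1)\<close>\<close>

text \<open>\<open>Superfun f g\<close> is the superfunction \<open>f(x) + \<theta> g(x)\<close>; the coordinate \<open>\<theta>\<close> satisfies
  \<open>\<theta>\<^sup>2 = 0\<close> and commutes with the functions of \<open>x\<close>.\<close>

datatype superfun = Superfun (body: smooth_fun) (soul: smooth_fun)

instantiation superfun :: real_algebra_1
begin
definition "0 = Superfun 0 0"
definition "1 = Superfun 1 0"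
definition "F + G = Superfun (body F + body G) (soul F + soul G)"
definition "F - G = Superfun (body F - body G) (soul F - soul G)"
definition "- F = Superfun (- body F) (- soul F)"
definition "F * G = Superfun (body F * body G) (body F * soul G + soul F * body G)"
definition "c *\<^sub>R F = Superfun (c *\<^sub>R body F) (c *\<^sub>R soul F)"
instance
  by standard (auto simp: zero_superfun_def one_superfun_def plus_superfun_def minus_superfun_def
    uminus_superfun_def times_superfun_def scaleR_superfun_def algebra_simps)
end

lemma superfun_simps [simp]:
  "body 0 = 0" "soul 0 = 0" "body 1 = 1" "soul 1 = 0"
  "body (F + G) = body F + body G" "soul (F + G) = soul F + soul G"
  "body (F - G) = body F - body G" "soul (F - G) = soul F - soul G"
  "body (- F) = - body F" "soul (- F) = - soul F"
  "body (F * G) = body F * body G" "soul (F * G) = body F * soul G + soul F * body G"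
  "body (c *\<^sub>R F) = c *\<^sub>R body F" "soul (c *\<^sub>R F) = c *\<^sub>R soul F"
  by (simp_all add: zero_superfun_def one_superfun_def plus_superfun_def minus_superfun_def
    uminus_superfun_def times_superfun_def scaleR_superfun_def)

definition theta :: superfun where "theta = Superfun 0 1"

definition superfun_part :: "bit \<Rightarrow> superfun set" where
  "superfun_part p = (if p = 0 then {F. soul F = 0} else {F. body F = 0})"

definition superfun_proj :: "bit \<Rightarrow> superfun \<Rightarrow> superfun" where
  "superfun_proj p F = (if p = 0 then Superfun (body F) 0 else Superfun 0 (soul F))"

definition d_dx :: "superfun \<Rightarrow> superfun" where
  "d_dx F = Superfun (derivative (body F)) (derivative (soul F))"

definition d_dtheta :: "superfun \<Rightarrow> superfun" where
  "d_dtheta F = Superfun (soul F) 0"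


section \<open>Vector fields on \<open>R^(1|1)\<close>\<close>

definition superderivation :: "bit \<Rightarrow> (superfun \<Rightarrow> superfun) \<Rightarrow> bool" where
  "superderivation p D \<longleftrightarrow> linear D \<and>
     (\<forall>q. \<forall>F\<in>superfun_part q. D F \<in> superfun_part (p + q)) \<and>
     (\<forall>q. \<forall>F\<in>superfun_part q. \<forall>G. D (F * G) = D F * G + ksign p q *\<^sub>R (F * D G))"

text \<open>A vector field is a derivation of the superalgebra of smooth superfunctions. It need not be
  homogeneous: it is the sum of an even and an odd superderivation.\<close>

typedef vector_field =
  "{X. \<exists>X0 X1. superderivation 0 X0 \<and> superderivation 1 X1 \<and> X = (\<lambda>F. X0 F + X1 F)}"
  morphisms apply_vf Abs_vector_field
proof -
  have "superderivation p (\<lambda>F. 0)" for p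
    by (auto simp: superderivation_def linear_iff superfun_part_def)
  then show ?thesis by blast
qed

setup_lifting type_definition_vector_field

lemma superderivation_zero: "superderivation p (\<lambda>F. 0)"
  by (auto simp: superderivation_def linear_iff superfun_part_def)

lemma subspace_superfun_part: "subspace (superfun_part p)"
  by (auto simp: subspace_def superfun_part_def)

lemma superderivation_add:
  assumes "superderivation p D" "superderivation p E"
  shows "superderivation p (\<lambda>F. D F + E F)"
  using assms subspace_add[OF subspace_superfun_part]
  unfolding superderivation_def linear_iff by (auto simp: algebra_simps)

lemma superderivation_scaleR:
  assumes "superderivation p D"
  shows "superderivation p (\<lambda>F. c *\<^sub>R D F)"
  using assms subspace_scale[OF subspace_superfun_part]
  unfolding superderivation_def linear_iff by (auto simp: algebra_simps)

lemma superderivation_uminus: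
  "superderivation p D \<Longrightarrow> superderivation p (\<lambda>F. - D F)"
  using superderivation_scaleR[of p D "-1"] by simp

lemma superderivation_minus:
  "superderivation p D \<Longrightarrow> superderivation p E \<Longrightarrow> superderivation p (\<lambda>F. D F - E F)"
  using superderivation_add[OF _ superderivation_uminus] by simp

instantiation vector_field :: real_vector
begin
lift_definition zero_vector_field :: vector_field is "\<lambda>F. 0"
  using superderivation_zero by fastforce
lift_definition plus_vector_field :: "vector_field \<Rightarrow> vector_field \<Rightarrow> vector_field"
  is "\<lambda>X Y F. X F + Y F"
proof -
  fix X Y :: "superfun \<Rightarrow> superfun"
  assume "\<exists>X0 X1. superderivation 0 X0 \<and> superderivation 1 X1 \<and> X = (\<lambda>F. X0 F + X1 F)"
    and "\<exists>X0 X1. superderivation 0 X0 \<and> superderivation 1 X1 \<and> Y = (\<lambda>F. X0 F + X1 F)"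
  then obtain X0 X1 Y0 Y1 where *: "superderivation 0 X0" "superderivation 1 X1"
    "superderivation 0 Y0" "superderivation 1 Y1"
    "X = (\<lambda>F. X0 F + X1 F)" "Y = (\<lambda>F. Y0 F + Y1 F)" by blast
  show "\<exists>X0 X1. superderivation 0 X0 \<and> superderivation 1 X1 \<and>
      (\<lambda>F. X F + Y F) = (\<lambda>F. X0 F + X1 F)"
    by (rule exI[of _ "\<lambda>F. X0 F + Y0 F"], rule exI[of _ "\<lambda>F. X1 F + Y1 F"])
      (use * in \<open>auto intro: superderivation_add\<close>)
qed
lift_definition scaleR_vector_field :: "real \<Rightarrow> vector_field \<Rightarrow> vector_field"
  is "\<lambda>c X F. c *\<^sub>R X F"
proof -
  fix c and X :: "superfun \<Rightarrow> superfun"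
  assume "\<exists>X0 X1. superderivation 0 X0 \<and> superderivation 1 X1 \<and> X = (\<lambda>F. X0 F + X1 F)"
  then obtain X0 X1 where *: "superderivation 0 X0" "superderivation 1 X1"
    "X = (\<lambda>F. X0 F + X1 F)" by blast
  show "\<exists>X0 X1. superderivation 0 X0 \<and> superderivation 1 X1 \<and>
      (\<lambda>F. c *\<^sub>R X F) = (\<lambda>F. X0 F + X1 F)"
    by (rule exI[of _ "\<lambda>F. c *\<^sub>R X0 F"], rule exI[of _ "\<lambda>F. c *\<^sub>R X1 F"])
      (use * in \<open>auto intro: superderivation_scaleR simp: scaleR_add_right\<close>)
qed
definition uminus_vector_field :: "vector_field \<Rightarrow> vector_field" where
  "- X = (-1) *\<^sub>R X" for X :: vector_field
definition minus_vector_field :: "vector_field \<Rightarrow> vector_field \<Rightarrow> vector_field" where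
  "X - Y = X + (-1) *\<^sub>R Y" for X Y :: vector_field
instance
proof
  fix X :: vector_field
  show "- X + X = 0" unfolding uminus_vector_field_def
    by (transfer, simp)
qed (simp add: uminus_vector_field_def minus_vector_field_def
  | (transfer, simp add: algebra_simps))+
end


definition vf_part :: "bit \<Rightarrow> vector_field set" where
  "vf_part p = {X. superderivation p (apply_vf X)}"

text \<open>The parity \<open>p\<close> component of an operator on superfunctions.\<close>

definition op_component :: "bit \<Rightarrow> (superfun \<Rightarrow> superfun) \<Rightarrow> superfun \<Rightarrow> superfun" where
  "op_component p X F =
     superfun_proj p (X (superfun_proj 0 F)) + superfun_proj (p + 1) (X (superfun_proj 1 F))"

lemma superfun_proj_part: "superfun_proj p F \<in> superfun_part p"
  by (simp add: superfun_proj_def superfun_part_def)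

lemma superfun_proj_sum: "superfun_proj 0 F + superfun_proj 1 F = F"
  by (simp add: superfun_proj_def superfun.expand)

lemma superfun_proj_on_part:
  "F \<in> superfun_part q \<Longrightarrow> superfun_proj p F = (if p = q then F else 0)"
  by (cases p; cases q)
    (auto simp: superfun_proj_def superfun_part_def superfun.expand)

lemma op_component_eq:
  assumes "superderivation 0 X0" "superderivation 1 X1"
  shows "op_component p (\<lambda>F. X0 F + X1 F) = (if p = 0 then X0 else X1)"
proof
  fix F
  define A B where "A = superfun_proj 0 F" and "B = superfun_proj 1 F"
  have AB: "A \<in> superfun_part 0" "B \<in> superfun_part 1" "F = A + B"
    unfolding A_def B_def by (auto simp: superfun_proj_part superfun_proj_sum)
  have m: "X0 A \<in> superfun_part 0" "X0 B \<in> superfun_part 1"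
    "X1 A \<in> superfun_part 1" "X1 B \<in> superfun_part 0"
    using assms AB unfolding superderivation_def by (metis add_0 add_0_right bit_arith)+
  have l: "X0 F = X0 A + X0 B" "X1 F = X1 A + X1 B"
    using assms AB unfolding superderivation_def by (auto simp: linear_add)
  have pr: "superfun_proj r (G + H) = superfun_proj r G + superfun_proj r H" for r G H
    by (simp add: superfun_proj_def superfun.expand)
  show "op_component p (\<lambda>F. X0 F + X1 F) F = (if p = 0 then X0 else X1) F"
    unfolding op_component_def A_def[symmetric] B_def[symmetric]
    by (cases p) (simp_all add: pr superfun_proj_on_part[OF m(1)] superfun_proj_on_part[OF m(2)]
      superfun_proj_on_part[OF m(3)] superfun_proj_on_part[OF m(4)] l)
qed

definition homogeneous_commutator ::
  "bit \<Rightarrow> bit \<Rightarrow> (superfun \<Rightarrow> superfun) \<Rightarrow> (superfun \<Rightarrow> superfun) \<Rightarrow> superfun \<Rightarrow> superfun" where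
  "homogeneous_commutator p q D E F = D (E F) - ksign p q *\<^sub>R E (D F)"

lemma superderivation_commutator:
  assumes D: "superderivation p D" and E: "superderivation q E"
  shows "superderivation (p + q) (homogeneous_commutator p q D E)"
proof -
  have lD: "D (x + y) = D x + D y" "D (c *\<^sub>R x) = c *\<^sub>R D x"
    and lE: "E (x + y) = E x + E y" "E (c *\<^sub>R x) = c *\<^sub>R E x" for x y c
    using D E by (auto simp: superderivation_def linear_iff)
  have dD: "D F \<in> superfun_part (p + r)" and dE: "E F \<in> superfun_part (q + r)"
    and pD: "D (F * G) = D F * G + ksign p r *\<^sub>R (F * D G)"
    and pE: "E (F * G) = E F * G + ksign q r *\<^sub>R (F * E G)"
    if "F \<in> superfun_part r" for F G r
    using D E that by (auto simp: superderivation_def)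
  show ?thesis unfolding superderivation_def
  proof (intro conjI allI ballI)
    show "linear (homogeneous_commutator p q D E)"
      by (auto simp: linear_iff homogeneous_commutator_def lD lE algebra_simps)
  next
    fix r F assume F: "F \<in> superfun_part r"
    have "D (E F) \<in> superfun_part (p + q + r)"
      using dD[OF dE[OF F]] by (simp only: add.assoc)
    moreover have "E (D F) \<in> superfun_part (p + q + r)"
      using dE[OF dD[OF F]] by (simp only: add.assoc add.left_commute)
    ultimately show "homogeneous_commutator p q D E F \<in> superfun_part (p + q + r)"
      unfolding homogeneous_commutator_def using subspace_superfun_part
      by (intro subspace_diff subspace_scale)
  next
    fix r F G assume F: "F \<in> superfun_part r"
    have k: "ksign p (q + r) = ksign p q * ksign p r" "ksign (p + q) r = ksign p r * ksign q r"
      "ksign q (p + r) = ksign p q * ksign q r"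
      by (cases p; cases q; cases r; simp add: ksign_def)+
    have e1: "D (E (F * G)) = D (E F) * G + (ksign p q * ksign p r) *\<^sub>R (E F * D G)
        + ksign q r *\<^sub>R (D F * E G) + (ksign q r * ksign p r) *\<^sub>R (F * D (E G))"
      by (simp only: pE[OF F] pD[OF F] pD[OF dE[OF F]] lD k scaleR_add_right scaleR_scaleR add.assoc)
    have e2: "E (D (F * G)) = E (D F) * G + (ksign p q * ksign q r) *\<^sub>R (D F * E G)
        + ksign p r *\<^sub>R (E F * D G) + (ksign p r * ksign q r) *\<^sub>R (F * E (D G))"
      by (simp only: pE[OF F] pD[OF F] pE[OF dD[OF F]] lE k scaleR_add_right scaleR_scaleR add.assoc)
    show "homogeneous_commutator p q D E (F * G) =
        homogeneous_commutator p q D E F * G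
          + ksign (p + q) r *\<^sub>R (F * homogeneous_commutator p q D E G)"
      unfolding homogeneous_commutator_def k(2) e1 e2
      by (cases p; cases q; cases r; simp add: ksign_def algebra_simps)
  qed
qed

text \<open>\<open>X Y - (-1)^(p * q) Y X\<close> on homogeneous vector fields of parities \<open>p\<close> and \<open>q\<close>,
  extended biadditively to all vector fields through their homogeneous components.\<close>

lift_definition super_commutator :: "vector_field \<Rightarrow> vector_field \<Rightarrow> vector_field" is
  "\<lambda>X Y F. \<Sum>p\<in>{0,1}. \<Sum>q\<in>{0,1}.
     homogeneous_commutator p q (op_component p X) (op_component q Y) F"
proof -
  fix X Y :: "superfun \<Rightarrow> superfun"
  assume "\<exists>X0 X1. superderivation 0 X0 \<and> superderivation 1 X1 \<and> X = (\<lambda>F. X0 F + X1 F)"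
    and "\<exists>X0 X1. superderivation 0 X0 \<and> superderivation 1 X1 \<and> Y = (\<lambda>F. X0 F + X1 F)"
  then have *: "superderivation p (op_component p X)" "superderivation p (op_component p Y)" for p
    by (cases p; auto simp: op_component_eq)+
  let ?c = "\<lambda>p q. homogeneous_commutator p q (op_component p X) (op_component q Y)"
  have c: "superderivation (p + q) (?c p q)" for p q
    by (intro superderivation_commutator *)
  show "\<exists>X0 X1. superderivation 0 X0 \<and> superderivation 1 X1 \<and>
      (\<lambda>F. \<Sum>p\<in>{0,1}. \<Sum>q\<in>{0,1}. ?c p q F) = (\<lambda>F. X0 F + X1 F)"
    by (rule exI[of _ "\<lambda>F. ?c 0 0 F + ?c 1 1 F"], rule exI[of _ "\<lambda>F. ?c 0 1 F + ?c 1 0 F"])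
      (use c[of 0 0] c[of 1 1] c[of 0 1] c[of 1 0] in
        \<open>auto intro: superderivation_add simp: algebra_simps\<close>)
qed


section \<open>Supertranslations in \<open>(1|1)\<close> dimensions\<close>

lemma superderivation_d_dx: "superderivation 0 d_dx"
  by (auto simp: superderivation_def linear_iff superfun_part_def d_dx_def ksign_def
    algebra_simps intro!: superfun.expand)

lemma superderivation_Q: "superderivation 1 (\<lambda>F. d_dtheta F + theta * d_dx F)"
  unfolding superderivation_def all_bit
  by (auto simp: linear_iff superfun_part_def d_dx_def d_dtheta_def theta_def ksign_def
    algebra_simps intro!: superfun.expand)

lift_definition vf_dx :: vector_field is d_dx
  using superderivation_d_dx superderivation_zero by fastforce

lift_definition vf_Q :: vector_field is "\<lambda>F. d_dtheta F + theta * d_dx F"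
  using superderivation_Q superderivation_zero by fastforce

text \<open>The parts carry the parity of vector fields; note that \<open>[Q, Q] = 2 d/dx\<close>.\<close>

definition supertranslations :: "bit \<Rightarrow> vector_field set" where
  "supertranslations p = span {vf_Q, vf_dx} \<inter> vf_part p"


section \<open>The gauge algebra of the \<open>C\<close>-field and its dual\<close>

definition gauge_part :: "'m::real_vector \<Rightarrow> 'm \<Rightarrow> bit \<Rightarrow> 'm set" where
  "gauge_part v3 v6 p = (if p = 0 then span {v6} else span {v3})"

end

theory Submission
  imports Defs
begin

text \<open>The isomorphism sends \<open>v3\<close> to \<open>Q\<close> and \<open>v6\<close> to \<open>2 d/dx = [Q, Q]\<close>. The fields \<open>Q\<close> and \<open>d/dx\<close>
  are told apart, and their parities detected, by their values on \<open>\<theta>\<close> (namely \<open>1\<close> and \<open>0\<close>) and on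
  \<open>x\<close> (namely \<open>\<theta>\<close> and \<open>1\<close>).\<close>

lemma smooth_ident: "smooth (\<lambda>x. x)"
  unfolding smooth_iff[of "\<lambda>x. x"] by (auto simp: smooth_const field_differentiable_ident)

lift_definition coord_fun :: smooth_fun is "\<lambda>x. x"
  by (rule smooth_ident)

lemma derivative_coord_fun [simp]: "derivative coord_fun = 1"
  by transfer (simp add: fun_eq_iff)

lemma derivative_one [simp]: "derivative 1 = 0"
  by transfer (simp add: fun_eq_iff)

definition coord :: superfun where "coord = Superfun coord_fun 0"

lemma coord_part: "coord \<in> superfun_part 0"
  by (simp add: coord_def superfun_part_def)

lemma theta_part: "theta \<in> superfun_part 1"
  by (simp add: theta_def superfun_part_def)

abbreviation vf_comb :: "real \<Rightarrow> real \<Rightarrow> vector_field" where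
  "vf_comb a b \<equiv> a *\<^sub>R vf_Q + b *\<^sub>R vf_dx"

text \<open>The even term is put first, so that the right-hand side has the shape
  \<open>X0 F + X1 F\<close> from which \<open>op_component_eq\<close> reads off the homogeneous
  components.\<close>

lemma apply_vf_comb:
  "apply_vf (vf_comb a b) F = b *\<^sub>R d_dx F + a *\<^sub>R (d_dtheta F + theta * d_dx F)"
  by transfer (simp add: algebra_simps)

lemma apply_vf_comb_theta: "apply_vf (vf_comb a b) theta = a *\<^sub>R 1"
  unfolding apply_vf_comb
  by (auto simp: theta_def d_dx_def d_dtheta_def intro!: superfun.expand)

lemma apply_vf_comb_coord: "apply_vf (vf_comb a b) coord = b *\<^sub>R 1 + a *\<^sub>R theta"
  unfolding apply_vf_comb
  by (auto simp: coord_def theta_def d_dx_def d_dtheta_def intro!: superfun.expand)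

text \<open>Linear independence of \<open>vf_Q\<close> and \<open>vf_dx\<close>: the value at
  \<open>theta\<close> determines the first coefficient, and then the value at \<open>coord\<close>
  determines the second.\<close>

lemma vf_comb_eq_iff: "vf_comb a b = vf_comb c d \<longleftrightarrow> a = c \<and> b = d"
proof
  assume eq: "vf_comb a b = vf_comb c d"
  have "a *\<^sub>R 1 = c *\<^sub>R (1::superfun)"
    using arg_cong[OF eq, of "\<lambda>X. apply_vf X theta"] by (simp only: apply_vf_comb_theta)
  then have "a = c" by simp
  moreover have "b *\<^sub>R 1 + a *\<^sub>R theta = d *\<^sub>R 1 + c *\<^sub>R theta"
    using arg_cong[OF eq, of "\<lambda>X. apply_vf X coord"] by (simp only: apply_vf_comb_coord)
  ultimately show "a = c \<and> b = d" by simp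
qed simp

text \<open>An even derivation sends the odd \<open>theta\<close> to an odd superfunction, but the
  value there is the constant \<open>a\<close>, which is even.\<close>

lemma vf_comb_even_iff: "vf_comb a b \<in> vf_part 0 \<longleftrightarrow> a = 0"
proof
  assume "vf_comb a b \<in> vf_part 0"
  then have "apply_vf (vf_comb a b) theta \<in> superfun_part (0 + 1)"
    using theta_part by (simp only: vf_part_def mem_Collect_eq superderivation_def)
  then show "a = 0"
    by (simp add: apply_vf_comb_theta superfun_part_def)
next
  assume "a = 0"
  then have "apply_vf (vf_comb a b) = (\<lambda>F. b *\<^sub>R d_dx F)"
    \<comment> \<open>The summand with coefficient 0 has to survive until
      \<open>apply_vf_comb\<close> has matched.\<close>
    by (simp only: fun_eq_iff apply_vf_comb) simp
  then show "vf_comb a b \<in> vf_part 0"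
    using superderivation_scaleR[OF superderivation_d_dx] by (simp add: vf_part_def)
qed

text \<open>An odd derivation sends the even \<open>coord\<close> to an odd superfunction, so the
  body of the value, which is the constant \<open>b\<close>, vanishes.\<close>

lemma vf_comb_odd_iff: "vf_comb a b \<in> vf_part 1 \<longleftrightarrow> b = 0"
proof
  assume "vf_comb a b \<in> vf_part 1"
  then have "apply_vf (vf_comb a b) coord \<in> superfun_part (1 + 0)"
    using coord_part by (simp only: vf_part_def mem_Collect_eq superderivation_def)
  then show "b = 0"
    by (simp add: apply_vf_comb_coord superfun_part_def theta_def)
next
  assume "b = 0"
  then have "apply_vf (vf_comb a b) = (\<lambda>F. a *\<^sub>R (d_dtheta F + theta * d_dx F))"
    by (simp only: fun_eq_iff apply_vf_comb) simp
  then show "vf_comb a b \<in> vf_part 1"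
    using superderivation_scaleR[OF superderivation_Q] by (simp add: vf_part_def)
qed

lemma span_pair: "span {u, v} = {a *\<^sub>R u + b *\<^sub>R v | a b. True}"
  for u v :: "'a::real_vector"
  unfolding span_insert span_singleton
  by (auto simp: algebra_simps)

lemma supertranslations_even: "supertranslations 0 = range (vf_comb 0)"
proof (intro equalityI subsetI)
  fix X assume "X \<in> supertranslations 0"
  then obtain a b where X: "X = vf_comb a b" "vf_comb a b \<in> vf_part 0"
    unfolding supertranslations_def span_pair by blast
  from X(2) have a: "a = 0" by (simp only: vf_comb_even_iff)
  show "X \<in> range (vf_comb 0)" unfolding X(1) a by (rule rangeI)
next
  fix X assume "X \<in> range (vf_comb 0)"
  then obtain c where X: "X = vf_comb 0 c" by (rule rangeE)
  have "X \<in> vf_part 0" unfolding X vf_comb_even_iff ..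
  moreover have "X \<in> span {vf_Q, vf_dx}" unfolding X span_pair by blast
  ultimately show "X \<in> supertranslations 0" unfolding supertranslations_def by simp
qed

lemma supertranslations_odd: "supertranslations 1 = range (\<lambda>a. vf_comb a 0)"
proof (intro equalityI subsetI)
  fix X assume "X \<in> supertranslations 1"
  then obtain a b where X: "X = vf_comb a b" "vf_comb a b \<in> vf_part 1"
    unfolding supertranslations_def span_pair by blast
  from X(2) have b: "b = 0" by (simp only: vf_comb_odd_iff)
  show "X \<in> range (\<lambda>a. vf_comb a 0)" unfolding X(1) b by (rule rangeI)
next
  fix X assume "X \<in> range (\<lambda>a. vf_comb a 0)"
  then obtain c where X: "X = vf_comb c 0" by (rule rangeE)
  have "X \<in> vf_part 1" unfolding X vf_comb_odd_iff ..
  moreover have "X \<in> span {vf_Q, vf_dx}" unfolding X span_pair by blast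
  ultimately show "X \<in> supertranslations 1" unfolding supertranslations_def by simp
qed

lemma op_component_vf_comb:
  "op_component p (apply_vf (vf_comb a b)) =
    (if p = 0 then (\<lambda>F. b *\<^sub>R d_dx F) else (\<lambda>F. a *\<^sub>R (d_dtheta F + theta * d_dx F)))"
  unfolding apply_vf_comb[abs_def]
  by (rule op_component_eq)
    (intro superderivation_scaleR superderivation_d_dx superderivation_Q)+

text \<open>\<open>vf_dx\<close> commutes with itself and with \<open>vf_Q\<close>, while applying
  \<open>vf_Q\<close> twice gives \<open>vf_dx\<close>; the anticommutator of \<open>vf_Q\<close>
  with itself is therefore twice \<open>vf_dx\<close>, and only the product of the odd coefficients
  survives.\<close>

lemma super_commutator_vf_comb:
  "super_commutator (vf_comb a b) (vf_comb c d) = vf_comb 0 (2 * (a * c))"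
proof -
  have "apply_vf (super_commutator (vf_comb a b) (vf_comb c d)) F =
      apply_vf (vf_comb 0 (2 * (a * c))) F" for F
    unfolding super_commutator.rep_eq op_component_vf_comb apply_vf_comb
    by (auto simp: homogeneous_commutator_def ksign_def d_dx_def d_dtheta_def theta_def
      algebra_simps intro!: superfun.expand)
      (simp_all add: scaleR_conv_of_real mult_ac)
  then show ?thesis
    by (simp only: apply_vf_inject[symmetric] fun_eq_iff) blast
qed

theorem proposition4p2:
  fixes v3 v6 :: "'m::real_vector"
    and br :: "'m \<Rightarrow> 'm \<Rightarrow> 'm"
  assumes basis: "v3 \<noteq> v6" "independent {v3, v6}" "span {v3, v6} = UNIV"
    and bilinear: "bilinear br"
    and brackets: "br v3 v3 = v6" "br v3 v6 = 0" "br v6 v3 = 0" "br v6 v6 = 0"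
  shows "lie_superalgebra (gauge_part v3 v6) br
    \<and> lie_superalgebra_isomorphic (gauge_part v3 v6) br supertranslations super_commutator"
proof
  define V where "V = gauge_part v3 v6"
  have V0: "V 0 = range (\<lambda>b. b *\<^sub>R v6)" and V1: "V 1 = range (\<lambda>a. a *\<^sub>R v3)"
    by (simp_all add: V_def gauge_part_def span_singleton)
  have all: "\<exists>a b. x = a *\<^sub>R v3 + b *\<^sub>R v6" for x
    using basis(3) unfolding span_pair by blast
  \<comment> \<open>The basis spans the whole type, so the carrier conditions become
    trivial.\<close>
  have carrier: "super_carrier V = UNIV"
  proof (intro UNIV_eq_I[symmetric])
    fix x
    obtain a b where "x = b *\<^sub>R v6 + a *\<^sub>R v3"
      using all[of x] by (auto simp: add.commute)
    then show "x \<in> super_carrier V"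
      unfolding super_carrier_def V0 V1 by blast
  qed
  note bil = bilinear_ladd[OF bilinear] bilinear_radd[OF bilinear]
    bilinear_lmul[OF bilinear] bilinear_rmul[OF bilinear]
    bilinear_lzero[OF bilinear] bilinear_rzero[OF bilinear]
  have br: "br (a *\<^sub>R v3 + b *\<^sub>R v6) (c *\<^sub>R v3 + d *\<^sub>R v6) = (a * c) *\<^sub>R v6" for a b c d
    by (simp add: bil brackets)
  \<comment> \<open>Linear extension from the basis; the else branch prescribes the value at
    \<open>v6\<close>, which is distinct from \<open>v3\<close>.\<close>
  obtain \<phi> where \<phi>: "linear \<phi>" "\<phi> v3 = vf_Q" "\<phi> v6 = 2 *\<^sub>R vf_dx"
    using linear_independent_extend[OF basis(2), of "\<lambda>v. if v = v3 then vf_Q else 2 *\<^sub>R vf_dx"]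
      basis(1) by auto
  have \<phi>_comb: "\<phi> (a *\<^sub>R v3 + b *\<^sub>R v6) = vf_comb a (2 * b)" for a b
    by (simp add: linear_add[OF \<phi>(1)] linear_scale[OF \<phi>(1)] \<phi> mult.commute)
  have inj: "inj \<phi>"
  proof (rule injI)
    fix x y assume eq: "\<phi> x = \<phi> y"
    obtain a b c d where xy: "x = a *\<^sub>R v3 + b *\<^sub>R v6" "y = c *\<^sub>R v3 + d *\<^sub>R v6"
      using all[of x] all[of y] by blast
    with eq show "x = y" by (simp only: \<phi>_comb vf_comb_eq_iff) simp
  qed

  have "lie_superalgebra V br"
  proof
    show "subspace (V p)" for p
      by (simp add: V_def gauge_part_def)
    show "V 0 \<inter> V 1 = {0}"
    proof -
      \<comment> \<open>The independence of \<open>v3\<close> and \<open>v6\<close> is read off from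
        that of their images under \<open>\<phi>\<close>.\<close>
      have *: "a *\<^sub>R v3 = 0" if "a *\<^sub>R v3 = b *\<^sub>R v6" for a b
      proof -
        have "vf_comb a 0 = vf_comb 0 (2 * b)"
          using \<phi>_comb[of a 0] \<phi>_comb[of 0 b] that by simp
        then show ?thesis by (simp only: vf_comb_eq_iff) simp
      qed
      have "0 \<in> V 0 \<inter> V 1"
        by (simp add: V_def gauge_part_def span_zero)
      moreover have "x = 0" if x: "x \<in> V 0" "x \<in> V 1" for x
      proof -
        obtain a b where "x = b *\<^sub>R v6" "x = a *\<^sub>R v3"
          using x unfolding V0 V1 by blast
        then show ?thesis using *[of a b] by simp
      qed
      ultimately show ?thesis by blast
    qed
    show "br x y \<in> V (p + q)" if "x \<in> V p" "y \<in> V q" for x y p q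
      using that by (cases p; cases q)
        (auto simp: V_def gauge_part_def span_singleton span_zero bil brackets)
    show "br x y = - (ksign p q *\<^sub>R br y x)" if "x \<in> V p" "y \<in> V q" for x y p q
      using that by (cases p; cases q) (auto simp: V0 V1 bil brackets ksign_def)
    \<comment> \<open>Every bracket is a multiple of the central element \<open>v6\<close>, so each
      double bracket vanishes.\<close>
    show "br x (br y z) = br (br x y) z + ksign p q *\<^sub>R br y (br x z)" for x y z p q
    proof -
      obtain a b c d e f where "x = a *\<^sub>R v3 + b *\<^sub>R v6" "y = c *\<^sub>R v3 + d *\<^sub>R v6"
        "z = e *\<^sub>R v3 + f *\<^sub>R v6"
        using all[of x] all[of y] all[of z] by blast
      then show ?thesis by (simp add: bil brackets)
    qed
  qed (simp_all add: bil)
  then show "lie_superalgebra (gauge_part v3 v6) br" by (simp only: V_def)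

  have even: "\<phi> ` V 0 = supertranslations 0"
  proof -
    \<comment> \<open>\<open>\<phi>\<close> doubles the coefficient of \<open>v6\<close>, hence the
      preimage with coefficient \<open>b / 2\<close>.\<close>
    have "vf_comb 0 b \<in> \<phi> ` V 0" for b
      using \<phi>_comb[of 0 "b / 2"] unfolding V0
      by (intro image_eqI[of _ _ "(b / 2) *\<^sub>R v6"]) auto
    moreover have "\<phi> (b *\<^sub>R v6) = vf_comb 0 (2 * b)" for b
      using \<phi>_comb[of 0 b] by simp
    ultimately show ?thesis unfolding supertranslations_even V0 by blast
  qed
  have odd: "\<phi> ` V 1 = supertranslations 1"
    using \<phi>_comb[of _ 0] by (simp add: V1 image_image supertranslations_odd)
  have "\<phi> ` V p = supertranslations p" for p
    using even odd by (cases p) simp_all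
  \<comment> \<open>With \<open>UNIV\<close> written as \<open>super_carrier V\<close>, surjectivity
    reduces by additivity to the images of the two homogeneous parts.\<close>
  moreover have "range \<phi> = super_carrier supertranslations"
    unfolding carrier[symmetric] super_carrier_def even[symmetric] odd[symmetric]
  proof safe
    fix x y assume "x \<in> V 0" "y \<in> V 1"
    then show "\<exists>u v. \<phi> (x + y) = u + v \<and> u \<in> \<phi> ` V 0 \<and> v \<in> \<phi> ` V 1"
      using linear_add[OF \<phi>(1)] by blast
    show "\<phi> x + \<phi> y \<in> \<phi> ` {x + y |x y. x \<in> V 0 \<and> y \<in> V 1}"
      using \<open>x \<in> V 0\<close> \<open>y \<in> V 1\<close>
      by (intro image_eqI[of _ \<phi> "x + y"]) (simp add: linear_add[OF \<phi>(1)], blast)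
  qed
  \<comment> \<open>Both sides are \<open>vf_comb 0 (2 * (a * c))\<close>: the factor 2 comes from
    the image of \<open>v6\<close> on the left and from the anticommutator of \<open>vf_Q\<close>
    with itself on the right.\<close>
  moreover have "\<phi> (br x y) = super_commutator (\<phi> x) (\<phi> y)" for x y
  proof -
    obtain a b c d where xy: "x = a *\<^sub>R v3 + b *\<^sub>R v6" "y = c *\<^sub>R v3 + d *\<^sub>R v6"
      using all[of x] all[of y] by blast
    show ?thesis
      unfolding xy br \<phi>_comb super_commutator_vf_comb using \<phi>_comb[of 0 "a * c"] by simp
  qed
  ultimately have "lie_superalgebra_iso V br supertranslations super_commutator \<phi>"
    using inj by (simp add: lie_superalgebra_iso_def carrier
      bij_betw_def linear_add[OF \<phi>(1)] linear_scale[OF \<phi>(1)])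
  then show "lie_superalgebra_isomorphic (gauge_part v3 v6) br supertranslations super_commutator"
    unfolding lie_superalgebra_isomorphic_def V_def by blast
qed

end
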